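(* Let $F$ be a field of characteristic different from $2$, $R=F[t]$ and $K=F(t)$. Let $q=\sum_{i,j} a_{ij}(t)x_ix_j$ be a quadratic form over $R$ in variables $x_1,\ldots,x_n$, nondegenerate over $K$. Suppose that either (i) $q$ is anisotropic and each $a_{ij}$ is zero or has degree $0$ or $1$; or (ii) each $a_{ij}$ is constant (i.e. zero or of degree $0$), that is, $q$ is the extension to $R$ of a quadratic form over $F$. Then $q$ is an ADC form.
   Context: A quadratic form over a domain $R$ is a homogeneous polynomial $q\in R[x_1,\ldots,x_n]$ of degree $2$. It is isotropic if there is $a\in R^n\setminus\{0\}$ with $q(a)=0$, and anisotropic otherwise (anisotropy over $R$ is equivalent to anisotropy over the fraction field $K$). A quadratic form $q$ over $R$ is an ADC form if for all $d\in R$: if there exists $x\in K^n$ with $q(x)=d$, then there exists $y\in R^n$ with $q(y)=d$. *)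

theory Defs
  imports
    "HOL-Analysis.Analysis"
    "HOL-Computational_Algebra.Computational_Algebra"
    "HOL-Library.Poly_Mapping"
begin

text \<open>
  A value of \<open>('n, 'r) mpoly\<close> is a polynomial over \<open>'r\<close> in variables indexed by the finite
  type \<open>'n\<close>; it maps each exponent vector to its coefficient.
\<close>

type_synonym ('n, 'r) mpoly = "('n \<Rightarrow>\<^sub>0 nat) \<Rightarrow>\<^sub>0 'r"

definition Const :: "'r \<Rightarrow> ('n, 'r::zero) mpoly" where
  "Const c = Poly_Mapping.single 0 c"

definition Var :: "'n \<Rightarrow> ('n, 'r::zero_neq_one) mpoly" where
  "Var i = Poly_Mapping.single (Poly_Mapping.single i 1) 1"

definition eval_mpoly :: "('n::finite, 'r::comm_semiring_1) mpoly \<Rightarrow> 'r ^ 'n \<Rightarrow> 'r" where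
  "eval_mpoly p x =
     (\<Sum>m\<in>Poly_Mapping.keys p.
        Poly_Mapping.lookup p m * (\<Prod>i\<in>UNIV. x $ i ^ Poly_Mapping.lookup m i))"

definition fract_mpoly :: "('n, 'r::idom) mpoly \<Rightarrow> ('n, 'r fract) mpoly" where
  "fract_mpoly p = Poly_Mapping.map to_fract p"

text \<open>As usual, the zero polynomial counts as homogeneous of degree 2.\<close>

definition quadratic_form :: "('n::finite, 'r::idom) mpoly \<Rightarrow> bool" where
  "quadratic_form q \<longleftrightarrow>
     (\<forall>m\<in>Poly_Mapping.keys q. (\<Sum>i\<in>UNIV. Poly_Mapping.lookup m i) = 2)"

definition isotropic :: "('n::finite, 'r::idom) mpoly \<Rightarrow> bool" where
  "isotropic q \<longleftrightarrow> (\<exists>x. x \<noteq> 0 \<and> eval_mpoly q x = 0)"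

abbreviation anisotropic :: "('n::finite, 'r::idom) mpoly \<Rightarrow> bool" where
  "anisotropic q \<equiv> \<not> isotropic q"

definition polar_form :: "('n::finite, 'r::idom) mpoly \<Rightarrow> 'r ^ 'n \<Rightarrow> 'r ^ 'n \<Rightarrow> 'r" where
  "polar_form q x y = eval_mpoly q (x + y) - eval_mpoly q x - eval_mpoly q y"

text \<open>
  The polar form is twice the symmetric bilinear form of \<open>q\<close>; the factor 2 is harmless in
  characteristic different from 2. Over a field, triviality of the radical is equivalent to
  invertibility of the Gram matrix.
\<close>

definition nondegenerate :: "('n::finite, 'k::field) mpoly \<Rightarrow> bool" where
  "nondegenerate q \<longleftrightarrow> (\<forall>x. (\<forall>y. polar_form q x y = 0) \<longrightarrow> x = 0)"

definition ADC_form :: "('n::finite, 'r::idom) mpoly \<Rightarrow> bool" where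
  "ADC_form q \<longleftrightarrow> quadratic_form q \<and>
     (\<forall>d. (\<exists>x. eval_mpoly (fract_mpoly q) x = to_fract d) \<longrightarrow> (\<exists>y. eval_mpoly q y = d))"

end

theory Submission
  imports Defs
begin

text \<open>
  A rational representation of \<open>d\<close> is a polynomial solution of \<open>q v = d * f\<^sup>2\<close> with \<open>f \<noteq> 0\<close>
  (\<open>common_denominator\<close>), and the aim is to make \<open>f\<close> constant.

  If \<open>q\<close> is anisotropic with coefficients of degree at most \<open>1\<close>, this is the descent of Cassels
  and Pfister. Divide the coordinates of \<open>v\<close> by \<open>f\<close>, obtaining a quotient vector \<open>y\<close> and a
  remainder vector \<open>r\<close>. If \<open>r = 0\<close>, then \<open>q y = d\<close>. Otherwise the line through \<open>v / f\<close> and \<open>y\<close>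
  meets the quadric \<open>q = d\<close> in a second point; it has denominator \<open>g\<close>, where \<open>q r = f * g\<close>.
  Here \<open>g \<noteq> 0\<close> by anisotropy, and \<open>degree (q r) \<le> 2 * (degree f - 1) + 1\<close> gives
  \<open>degree g < degree f\<close> (\<open>descent_step\<close>, \<open>anisotropic_descent\<close>).

  An anisotropic form with constant coefficients falls under this case. If the coefficients are
  constant and \<open>q\<close> is isotropic, then there is an isotropic vector \<open>u\<close> with constant coordinates,
  and by nondegeneracy a constant vector \<open>w\<close> not orthogonal to \<open>u\<close>. Then
  \<open>q (\<alpha> *s u + w)\<close> is affine in \<open>\<alpha>\<close> with a unit as slope, so that \<open>q\<close> represents every
  polynomial (\<open>constant_isotropic_universal\<close>).

  Both arguments use the polar form only, never its half, and therefore need no symmetric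
  coefficient matrix.
\<close>

(* Below, $ only selects a component of a vector, never a coefficient of a power series. *)
no_notation fps_nth (infixl "$" 75)

section \<open>Evaluation of polynomials in several variables\<close>

lemma eval_mpoly_superset:
  assumes "finite S" "Poly_Mapping.keys p \<subseteq> S"
  shows "eval_mpoly p x =
    (\<Sum>m\<in>S. Poly_Mapping.lookup p m * (\<Prod>i\<in>UNIV. x $ i ^ Poly_Mapping.lookup m i))"
  unfolding eval_mpoly_def
  by (rule sum.mono_neutral_left) (use assms in \<open>auto simp: in_keys_iff\<close>)

lemma eval_mpoly_0 [simp]: "eval_mpoly 0 x = 0"
  by (simp add: eval_mpoly_def)

lemma eval_mpoly_add: "eval_mpoly (p + q) x = eval_mpoly p x + eval_mpoly q x"
proof -
  let ?S = "Poly_Mapping.keys p \<union> Poly_Mapping.keys q"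
  have "Poly_Mapping.keys (p + q) \<subseteq> ?S"
    by (rule Poly_Mapping.keys_add)
  then show ?thesis
    by (simp add: eval_mpoly_superset[of ?S] lookup_add sum.distrib distrib_right)
qed

lemma eval_mpoly_sum: "eval_mpoly (\<Sum>i\<in>A. p i) x = (\<Sum>i\<in>A. eval_mpoly (p i) x)"
  by (induction A rule: infinite_finite_induct) (simp_all add: eval_mpoly_add)

lemma Const_Var_Var:
  "Const c * Var i * Var j =
    Poly_Mapping.single (Poly_Mapping.single i 1 + Poly_Mapping.single j (1::nat)) (c::'r::comm_semiring_1)"
  by (simp add: Const_def Var_def mult_single)

lemma eval_mpoly_Const_Var_Var:
  fixes c :: "'r::comm_semiring_1"
  shows "eval_mpoly (Const c * Var i * Var j) x = c * x $ i * x $ j"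
proof -
  have single: "(\<Prod>k\<in>UNIV. x $ k ^ Poly_Mapping.lookup (Poly_Mapping.single l 1) k) = x $ l" for l
  proof -
    have "(\<Prod>k\<in>UNIV. x $ k ^ Poly_Mapping.lookup (Poly_Mapping.single l 1) k) =
        (\<Prod>k\<in>UNIV. if k = l then x $ k else 1)"
      by (rule prod.cong) (auto simp: lookup_single when_def)
    then show ?thesis by simp
  qed
  let ?m = "Poly_Mapping.single i 1 + Poly_Mapping.single j (1::nat)"
  have "eval_mpoly (Const c * Var i * Var j) x =
      (\<Sum>m\<in>{?m}. Poly_Mapping.lookup (Poly_Mapping.single ?m c) m *
        (\<Prod>k\<in>UNIV. x $ k ^ Poly_Mapping.lookup m k))"
    unfolding Const_Var_Var by (rule eval_mpoly_superset) auto
  also have "\<dots> = c * (\<Prod>k\<in>UNIV. x $ k ^ Poly_Mapping.lookup ?m k)"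
    by simp
  also have "\<dots> = c * x $ i * x $ j"
    by (simp only: lookup_add power_add prod.distrib single mult.assoc)
  finally show ?thesis .
qed

lemma lookup_fract_mpoly:
  "Poly_Mapping.lookup (fract_mpoly p) m = to_fract (Poly_Mapping.lookup p m)"
  by (simp add: fract_mpoly_def Poly_Mapping.map.rep_eq when_def)

lemma fract_mpoly_0 [simp]: "fract_mpoly 0 = 0"
  by (rule poly_mapping_eqI) (simp add: lookup_fract_mpoly)

lemma fract_mpoly_add: "fract_mpoly (p + q) = fract_mpoly p + fract_mpoly q"
  by (rule poly_mapping_eqI) (simp add: lookup_fract_mpoly lookup_add)

lemma fract_mpoly_sum: "fract_mpoly (\<Sum>i\<in>A. p i) = (\<Sum>i\<in>A. fract_mpoly (p i))"
  by (induction A rule: infinite_finite_induct) (simp_all add: fract_mpoly_add)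

lemma fract_mpoly_Const_Var_Var:
  "fract_mpoly (Const c * Var i * Var j) = Const (to_fract c) * Var i * Var j"
  by (rule poly_mapping_eqI)
    (simp add: lookup_fract_mpoly Const_Var_Var lookup_single when_def)

section \<open>Quadratic and bilinear forms given by a matrix\<close>

text \<open>The quadratic form with (not necessarily symmetric) coefficient matrix \<open>a\<close>.\<close>

definition matrix_form :: "('n::finite \<Rightarrow> 'n \<Rightarrow> 'r::comm_ring_1) \<Rightarrow> 'r ^ 'n \<Rightarrow> 'r" where
  "matrix_form a x = (\<Sum>i\<in>UNIV. \<Sum>j\<in>UNIV. a i j * x $ i * x $ j)"

text \<open>Its polar form, whose Gram matrix is the sum of \<open>a\<close> and its transpose.\<close>

definition matrix_polar :: "('n::finite \<Rightarrow> 'n \<Rightarrow> 'r::comm_ring_1) \<Rightarrow> 'r ^ 'n \<Rightarrow> 'r ^ 'n \<Rightarrow> 'r" where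
  "matrix_polar a x y = (\<Sum>k\<in>UNIV. (\<Sum>j\<in>UNIV. (a j k + a k j) * x $ j) * y $ k)"

lemma eval_mpoly_matrix:
  "eval_mpoly (\<Sum>i\<in>UNIV. \<Sum>j\<in>UNIV. Const (a i j) * Var i * Var j) x = matrix_form a x"
  by (simp add: eval_mpoly_sum eval_mpoly_Const_Var_Var matrix_form_def)

lemma eval_fract_mpoly_matrix:
  "eval_mpoly (fract_mpoly (\<Sum>i\<in>UNIV. \<Sum>j\<in>UNIV. Const (a i j) * Var i * Var j)) x =
    matrix_form (\<lambda>i j. to_fract (a i j)) x"
  by (simp add: fract_mpoly_sum fract_mpoly_Const_Var_Var eval_mpoly_matrix)

lemma quadratic_form_matrix:
  "quadratic_form (\<Sum>i\<in>UNIV. \<Sum>j\<in>UNIV. Const (a i j) * Var i * Var j :: ('n::finite, 'r::idom) mpoly)"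
proof -
  have deg: "(\<Sum>k\<in>UNIV. Poly_Mapping.lookup (Poly_Mapping.single i (1::nat) + Poly_Mapping.single j 1) k) = 2"
    for i j :: 'n
    by (simp add: lookup_add lookup_single when_def sum.distrib)
  have zero: "quadratic_form (0 :: ('n, 'r) mpoly)"
    by (simp add: quadratic_form_def)
  have add: "quadratic_form (p + q)" if "quadratic_form p" "quadratic_form q"
    for p q :: "('n, 'r) mpoly"
    using that Poly_Mapping.keys_add[of p q] by (auto simp: quadratic_form_def)
  have sum: "quadratic_form (\<Sum>i\<in>UNIV. p i)" if "\<And>i. quadratic_form (p i)"
    for p :: "'n \<Rightarrow> ('n, 'r) mpoly"
  proof -
    have "quadratic_form (\<Sum>i\<in>A. p i)" for A
      by (induction A rule: infinite_finite_induct) (use that zero add in auto)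
    then show ?thesis .
  qed
  have "quadratic_form (Const c * Var i * Var j :: ('n, 'r) mpoly)" for c i j
    using deg[of i j] by (auto simp: quadratic_form_def Const_Var_Var split: if_splits)
  then show ?thesis
    by (intro sum)
qed

lemma matrix_form_lincomb:
  "matrix_form a (c *s x + e *s y) =
    c\<^sup>2 * matrix_form a x + c * e * matrix_polar a x y + e\<^sup>2 * matrix_form a y"
proof -
  have swap: "(\<Sum>k\<in>UNIV. \<Sum>j\<in>UNIV. a j k * x $ j * y $ k) =
      (\<Sum>i\<in>UNIV. \<Sum>j\<in>UNIV. a i j * x $ i * y $ j)"
    by (rule sum.swap)
  have polar: "matrix_polar a x y =
      (\<Sum>i\<in>UNIV. \<Sum>j\<in>UNIV. a i j * x $ i * y $ j) + (\<Sum>i\<in>UNIV. \<Sum>j\<in>UNIV. a i j * x $ j * y $ i)"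
    unfolding matrix_polar_def
    by (simp add: sum_distrib_right distrib_right sum.distrib swap)
  have "matrix_form a (c *s x + e *s y) = (\<Sum>i\<in>UNIV. \<Sum>j\<in>UNIV.
      c\<^sup>2 * (a i j * x $ i * x $ j) + c * e * (a i j * x $ i * y $ j + a i j * x $ j * y $ i) +
      e\<^sup>2 * (a i j * y $ i * y $ j))"
    unfolding matrix_form_def
    by (intro sum.cong refl) (simp add: algebra_simps power2_eq_square)
  also have "\<dots> = c\<^sup>2 * matrix_form a x + c * e * matrix_polar a x y + e\<^sup>2 * matrix_form a y"
    unfolding polar matrix_form_def by (simp only: sum_distrib_left sum.distrib distrib_left)
  finally show ?thesis .
qed

lemma matrix_form_add:
  "matrix_form a (x + y) = matrix_form a x + matrix_polar a x y + matrix_form a y"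
  using matrix_form_lincomb[of a 1 x 1 y] by simp

lemma matrix_form_scale: "matrix_form a (c *s x) = c\<^sup>2 * matrix_form a x"
  using matrix_form_lincomb[of a c x 0 x] by simp

lemma matrix_polar_axis: "matrix_polar a x (axis k 1) = (\<Sum>j\<in>UNIV. (a j k + a k j) * x $ j)"
  by (simp add: matrix_polar_def axis_def if_distrib cong: if_cong)

section \<open>Clearing denominators\<close>

lemma matrix_form_to_fract:
  "matrix_form (\<lambda>i j. to_fract (a i j)) (\<chi> i. to_fract (x $ i)) = to_fract (matrix_form a x)"
  by (simp add: matrix_form_def)

lemma common_denominator:
  fixes x :: "'r::idom fract ^ 'n::finite"
  obtains f and v :: "'r ^ 'n" where "f \<noteq> 0" "to_fract f *s x = (\<chi> i. to_fract (v $ i))"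
proof -
  have "\<exists>p. snd p \<noteq> 0 \<and> x $ i = Fract (fst p) (snd p)" for i
    by (cases "x $ i") auto
  then obtain p where p: "\<And>i. snd (p i) \<noteq> 0" "\<And>i. x $ i = Fract (fst (p i)) (snd (p i))"
    by metis
  define f where "f = (\<Prod>i\<in>UNIV. snd (p i))"
  define v :: "'r ^ 'n" where "v = (\<chi> i. fst (p i) * (\<Prod>j\<in>UNIV - {i}. snd (p j)))"
  have "f \<noteq> 0"
    using p by (simp add: f_def)
  moreover have "to_fract f * x $ i = to_fract (v $ i)" for i
  proof -
    have "f = snd (p i) * (\<Prod>j\<in>UNIV - {i}. snd (p j))"
      unfolding f_def by (rule prod.remove) auto
    then show ?thesis
      using p(1)[of i] by (simp add: p(2) v_def to_fract_def eq_fract)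
  qed
  ultimately show thesis
    by (intro that[of f v]) (simp_all add: vec_eq_iff)
qed

section \<open>Anisotropic forms of degree at most one\<close>

text \<open>
  The descent step. The line through the rational point \<open>v / f\<close> and the polynomial point \<open>y\<close>
  obtained by rounding \<open>v / f\<close> meets the quadric \<open>matrix_form a = d\<close> in a second point, with
  denominator \<open>g\<close>, where \<open>f * g\<close> is the value of the form at the vector of remainders.
\<close>

lemma descent_step:
  fixes a :: "'n::finite \<Rightarrow> 'n \<Rightarrow> 'f::field poly"
  assumes aniso: "\<And>x. matrix_form a x = 0 \<Longrightarrow> x = 0"
    and deg: "\<And>i j. degree (a i j) \<le> 1"
    and f: "degree f > 0"
    and v: "matrix_form a v = d * f\<^sup>2"
  shows "(\<exists>y. matrix_form a y = d) \<or>
    (\<exists>g w. g \<noteq> 0 \<and> degree g < degree f \<and> matrix_form a w = d * g\<^sup>2)"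
proof -
  have f0: "f \<noteq> 0" using f by auto
  define y where "y = (\<chi> i. v $ i div f)"
  define r where "r = (\<chi> i. v $ i mod f)"
  define e where "e = matrix_form a y - d"
  have vec: "v = f *s y + 1 *s r"
    by (simp add: vec_eq_iff y_def r_def)
  have eq: "f\<^sup>2 * e + f * matrix_polar a y r + matrix_form a r = 0"
    using v unfolding vec matrix_form_lincomb e_def by (simp add: algebra_simps)
  show ?thesis
  proof (cases "r = 0")
    case True
    then have "matrix_form a v = f\<^sup>2 * matrix_form a y"
      by (simp add: vec matrix_form_scale)
    with v f0 have "matrix_form a y = d" by simp
    then show ?thesis by blast
  next
    case False
    \<comment> \<open>Dividing the equation by \<open>f\<close> shows that \<open>f\<close> divides the value at \<open>r\<close>, with cofactor \<open>g\<close>.\<close>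
    define g where "g = - (f * e + matrix_polar a y r)"
    have fg: "matrix_form a r = f * g"
      using eq by (simp add: g_def algebra_simps power2_eq_square eq_neg_iff_add_eq_0)
    have g0: "g \<noteq> 0"
      using aniso[of r] False fg by auto
    have r_deg: "degree (r $ i) \<le> degree f - 1" for i
      using degree_mod_less'[of f "v $ i"] f f0 by (cases "r $ i = 0") (auto simp: r_def)
    have "degree (a i j * r $ i * r $ j) \<le> 1 + (degree f - 1) + (degree f - 1)" for i j
      by (meson add_mono deg degree_mult_le order_trans r_deg)
    then have "degree (matrix_form a r) \<le> 1 + (degree f - 1) + (degree f - 1)"
      unfolding matrix_form_def by (intro degree_sum_le) auto
    then have "degree g < degree f"
      using f f0 g0 by (simp add: fg degree_mult_eq)
    \<comment> \<open>The second intersection point is \<open>y + (e / g) *s r\<close>, since on the line \<open>s \<mapsto> y + s *s r\<close>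
      one root is \<open>1 / f\<close> and the product of the roots is \<open>e / (f * g)\<close>.\<close>
    moreover have "matrix_form a (g *s y + e *s r) = d * g\<^sup>2"
    proof -
      have polar: "matrix_polar a y r = - g - f * e"
        by (simp add: g_def)
      have "matrix_form a y = d + e" by (simp add: e_def)
      then show ?thesis
        unfolding matrix_form_lincomb fg polar by (simp add: algebra_simps power2_eq_square)
    qed
    ultimately show ?thesis
      using g0 by blast
  qed
qed

lemma anisotropic_descent:
  fixes a :: "'n::finite \<Rightarrow> 'n \<Rightarrow> 'f::field poly"
  assumes aniso: "\<And>x. matrix_form a x = 0 \<Longrightarrow> x = 0"
    and deg: "\<And>i j. degree (a i j) \<le> 1"
    and "f \<noteq> 0" "matrix_form a v = d * f\<^sup>2"
  shows "\<exists>y. matrix_form a y = d"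
  using assms(3,4)
proof (induction "degree f" arbitrary: f v rule: less_induct)
  case less
  show ?case
  proof (cases "degree f = 0")
    case True
    then obtain c where c: "f = [:c:]" "c \<noteq> 0"
      using less.prems(1) by (metis degree_0_id pCons_0_0)
    have "matrix_form a ([:inverse c:] *s v) = d * ([:inverse c:] * f)\<^sup>2"
      unfolding matrix_form_scale less.prems(2) by (simp only: power_mult_distrib mult.left_commute)
    also have "[:inverse c:] * f = 1"
      using c by (simp add: one_pCons)
    finally show ?thesis by auto
  next
    case False
    then show ?thesis
      using descent_step[OF aniso deg _ less.prems(2)] less.hyps by blast
  qed
qed

section \<open>Isotropic forms with constant coefficients\<close>

lemma coeff_mult_top:
  fixes p q :: "'a::comm_semiring_0 poly"
  assumes "degree p \<le> m" "degree q \<le> n"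
  shows "coeff (p * q) (m + n) = coeff p m * coeff q n"
proof -
  have "coeff p i * coeff q (m + n - i) = 0" if "i \<noteq> m" "i \<le> m + n" for i
  proof (cases "i < m")
    case True
    then have "coeff q (m + n - i) = 0"
      using assms(2) by (intro coeff_eq_0) auto
    then show ?thesis by simp
  next
    case False
    then have "coeff p i = 0"
      using assms(1) that by (intro coeff_eq_0) auto
    then show ?thesis by simp
  qed
  then have "coeff (p * q) (m + n) = (\<Sum>i\<in>{m}. coeff p i * coeff q (m + n - i))"
    unfolding coeff_mult by (intro sum.mono_neutral_right) auto
  then show ?thesis by simp
qed

text \<open>
  The vector of coefficients of the highest degree occurring in an isotropic vector is again
  isotropic, because the form sees only these coefficients in top degree.
\<close>

lemma constant_isotropic_vector:
  fixes a :: "'n::finite \<Rightarrow> 'n \<Rightarrow> 'f::field poly"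
  assumes deg: "\<And>i j. degree (a i j) = 0"
    and x: "x \<noteq> 0" "matrix_form a x = 0"
  obtains u :: "'f poly ^ 'n" where "u \<noteq> 0" "\<And>i. degree (u $ i) = 0" "matrix_form a u = 0"
proof -
  define N where "N = Max (range (\<lambda>i. degree (x $ i)))"
  define u :: "'f poly ^ 'n" where "u = (\<chi> i. [:coeff (x $ i) N:])"
  have le: "degree (x $ i) \<le> N" for i
    unfolding N_def by (rule Max_ge) auto
  have "u \<noteq> 0"
  proof
    assume "u = 0"
    then have u0: "coeff (x $ i) N = 0" for i
      by (auto simp: u_def vec_eq_iff)
    have "N \<in> range (\<lambda>i. degree (x $ i))"
      unfolding N_def by (rule Max_in) auto
    then obtain k where "N = degree (x $ k)" by auto
    with u0[of k] have "N = 0" by auto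
    then have "x $ i = 0" for i
      using le[of i] u0[of i] by (auto elim!: degree_eq_zeroE)
    with x(1) show False by (simp add: vec_eq_iff)
  qed
  moreover have "matrix_form a u = [:coeff (matrix_form a x) (0 + N + N):]"
  proof -
    have "a i j * u $ i * u $ j = [:coeff (a i j * x $ i * x $ j) (0 + N + N):]" for i j
    proof -
      obtain c where c: "a i j = [:c:]"
        using deg[of i j] by (rule degree_eq_zeroE)
      have "degree (a i j * x $ i) \<le> 0 + N"
        using degree_mult_le[of "a i j" "x $ i"] deg[of i j] le[of i] by linarith
      then have "coeff (a i j * x $ i * x $ j) (0 + N + N) =
          coeff (a i j) 0 * coeff (x $ i) N * coeff (x $ j) N"
        using deg[of i j] le[of i] le[of j] by (simp only: coeff_mult_top order_refl)
      then show ?thesis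
        by (auto simp: c u_def mult.commute)
    qed
    then have "matrix_form a u =
        (\<Sum>i\<in>UNIV. \<Sum>j\<in>UNIV. [:coeff (a i j * x $ i * x $ j) (0 + N + N):])"
      unfolding matrix_form_def by simp
    also have "\<dots> = [:coeff (matrix_form a x) (0 + N + N):]"
      by (rule poly_eqI) (simp add: matrix_form_def coeff_sum coeff_pCons split: nat.split)
    finally show ?thesis .
  qed
  ultimately show thesis
    by (intro that[of u]) (auto simp: u_def x(2))
qed

text \<open>
  On the line \<open>\<alpha> \<mapsto> \<alpha> *s u + w\<close> through a basis vector \<open>w\<close> not orthogonal to \<open>u\<close>, the form
  is an affine function of \<open>\<alpha>\<close> whose slope is a nonzero constant, hence a unit.
\<close>

lemma constant_isotropic_universal:
  fixes a :: "'n::finite \<Rightarrow> 'n \<Rightarrow> 'f::field poly"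
  assumes deg: "\<And>i j. degree (a i j) = 0"
    and x: "x \<noteq> 0" "matrix_form a x = 0"
    and nondeg: "\<And>u. u \<noteq> 0 \<Longrightarrow> \<exists>k. matrix_polar a u (axis k 1) \<noteq> 0"
  shows "\<exists>y. matrix_form a y = d"
proof -
  obtain u where u: "u \<noteq> 0" "\<And>i. degree (u $ i) = 0" "matrix_form a u = 0"
    using constant_isotropic_vector[OF deg x] by blast
  obtain k where k: "matrix_polar a u (axis k 1) \<noteq> 0"
    using nondeg[OF u(1)] by blast
  define w :: "'f poly ^ 'n" where "w = axis k 1"
  define s where "s = matrix_polar a u w"
  have "degree ((a j k + a k j) * u $ j) \<le> 0" for j
    using degree_mult_le[of "a j k + a k j" "u $ j"] degree_add_le[of "a j k" 0 "a k j"]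
    by (simp add: deg u(2))
  then have "degree s \<le> 0"
    unfolding s_def w_def matrix_polar_axis by (intro degree_sum_le) auto
  then have "is_unit s"
    using k by (simp add: is_unit_iff_degree s_def w_def)
  then obtain \<alpha> where \<alpha>: "d - matrix_form a w = s * \<alpha>"
    by (meson dvdE unit_imp_dvd)
  have "matrix_form a (\<alpha> *s u + 1 *s w) = d"
    unfolding matrix_form_lincomb u(3) using \<alpha> by (simp add: s_def algebra_simps)
  then show ?thesis by blast
qed

text \<open>
  Nondegeneracy over the fraction field, in the form needed above: no nonzero vector over the
  ring itself is orthogonal to all basis vectors.
\<close>

lemma nondegenerate_polar_axis:
  fixes a :: "'n::finite \<Rightarrow> 'n \<Rightarrow> 'r::idom"
  assumes "nondegenerate (fract_mpoly (\<Sum>i\<in>UNIV. \<Sum>j\<in>UNIV. Const (a i j) * Var i * Var j))"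
    and "u \<noteq> 0"
  shows "\<exists>k. matrix_polar a u (axis k 1) \<noteq> 0"
proof (rule ccontr)
  assume "\<not> ?thesis"
  then have *: "matrix_polar a u (axis k 1) = 0" for k
    by blast
  let ?a = "\<lambda>i j. to_fract (a i j)" and ?u = "\<chi> i. to_fract (u $ i)"
  have "(\<Sum>j\<in>UNIV. (?a j k + ?a k j) * ?u $ j) = to_fract (matrix_polar a u (axis k 1))" for k
    by (simp add: matrix_polar_axis)
  then have "(\<Sum>j\<in>UNIV. (?a j k + ?a k j) * ?u $ j) = 0" for k
    by (simp only: * to_fract_0)
  then have "matrix_polar ?a ?u y = 0" for y
    unfolding matrix_polar_def by (simp only: mult_zero_left sum.neutral_const)
  then have "?u = 0"
    using assms(1)
    by (simp add: nondegenerate_def polar_form_def eval_fract_mpoly_matrix matrix_form_add)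
  with assms(2) show False
    by (simp add: vec_eq_iff)
qed

theorem theorem10:
  fixes a :: "'n::finite \<Rightarrow> 'n \<Rightarrow> 'f::field poly"
    and q :: "('n, 'f poly) mpoly"
  assumes "CHAR('f) \<noteq> 2"
    and "q = (\<Sum>i\<in>UNIV. \<Sum>j\<in>UNIV. Const (a i j) * Var i * Var j)"
    and "nondegenerate (fract_mpoly q)"
    and "(anisotropic q \<and> (\<forall>i j. a i j = 0 \<or> degree (a i j) = 0 \<or> degree (a i j) = 1))
       \<or> (\<forall>i j. a i j = 0 \<or> degree (a i j) = 0)"
  shows "ADC_form q"
proof -
  have eval: "eval_mpoly q y = matrix_form a y" for y
    by (simp add: assms(2) eval_mpoly_matrix)
  have "\<exists>y. eval_mpoly q y = d" if "eval_mpoly (fract_mpoly q) x = to_fract d" for d x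
  proof (cases "anisotropic q")
    case True
    have deg: "degree (a i j) \<le> 1" for i j
      using assms(4) by (metis degree_0 le_refl zero_le)
    obtain f v where f: "f \<noteq> 0" and fv: "to_fract f *s x = (\<chi> i. to_fract (v $ i))"
      by (rule common_denominator)
    have "to_fract (matrix_form a v) = matrix_form (\<lambda>i j. to_fract (a i j)) (to_fract f *s x)"
      by (simp add: fv matrix_form_to_fract)
    also have "\<dots> = to_fract (d * f\<^sup>2)"
      using that
      by (simp add: matrix_form_scale assms(2) eval_fract_mpoly_matrix power2_eq_square)
    finally have "matrix_form a v = d * f\<^sup>2"
      by (simp only: to_fract_eq_iff)
    have "z = 0" if "matrix_form a z = 0" for z
      using True that by (auto simp: isotropic_def eval)
    then have "\<exists>y. matrix_form a y = d"
      using deg f \<open>matrix_form a v = d * f\<^sup>2\<close> by (rule anisotropic_descent)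
    then show ?thesis
      by (simp add: eval)
  next
    case False
    then obtain z where z: "z \<noteq> 0" "matrix_form a z = 0"
      by (auto simp: isotropic_def eval)
    have deg: "degree (a i j) = 0" for i j
      using assms(4) False by (metis degree_0)
    have "\<exists>y. matrix_form a y = d"
      using deg z nondegenerate_polar_axis[OF assms(3)[unfolded assms(2)]]
      by (rule constant_isotropic_universal)
    then show ?thesis
      by (simp add: eval)
  qed
  then show ?thesis
    using quadratic_form_matrix[of a] by (auto simp: ADC_form_def assms(2))
qed

end
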